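(* Let $(E,\mathcal{E})$ be a Lusin space and let $\nu$ be a Markov kernel on $E$. Then there exist a measurable space $(F,\mathcal{F})$, a probability measure $\mu$ on $(F,\mathcal{F})$ and a dynamical system $\widetilde T$ on $E\times F$ (with the product $\sigma$-field) such that the Markov kernel associated to the restriction of $\widetilde T$ to $E$ is equal to $\nu$; that is, for every bounded measurable function $f$ on $E$ and every $x\in E$, $$\int_F (f\otimes \mathbf{1})(\widetilde T(x,y))\,d\mu(y)=\int_E f(z)\,\nu(x,dz).$$
   Context: A Lusin space is a measurable space which is isomorphic, as a measurable space, to a Borel subset of a compact metrizable space. A Markov kernel on $(E,\mathcal{E})$ is a map $\nu:E\times\mathcal{E}\to[0,1]$ such that $x\mapsto\nu(x,A)$ is measurable for every $A\in\mathcal{E}$ and $A\mapsto\nu(x,A)$ is a probability measure for every $x\in E$. A dynamical system on a measurable space is a measurable map from that space to itself. For $f$ on $E$, $f\otimes\mathbf{1}$ is the function on $E\times F$ given by $(f\otimes\mathbf{1})(x,y)=f(x)$. *)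

theory Defs
  imports "HOL-Probability.Probability"
begin

text \<open>A measurable space is represented by a \<^typ>\<open>'a measure\<close> of which only the carrier and the
  sigma-algebra are used.\<close>

definition borel_measure_of :: "'b topology \<Rightarrow> 'b measure" where
  "borel_measure_of K = sigma (topspace K) {U. openin K U}"

definition isomorphic_measurable :: "'a measure \<Rightarrow> 'b measure \<Rightarrow> bool" where
  "isomorphic_measurable M N \<longleftrightarrow>
     (\<exists>h \<in> M \<rightarrow>\<^sub>M N. \<exists>g \<in> N \<rightarrow>\<^sub>M M.
        (\<forall>x \<in> space M. g (h x) = x) \<and> (\<forall>y \<in> space N. h (g y) = y))"

text \<open>HOL cannot quantify existentially over types, so the type \<^typ>\<open>'b\<close> carrying the points of the
  compact metrizable space is a parameter. A theorem that assumes \<open>lusin_space TYPE('b) E\<close> with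
  \<^typ>\<open>'b\<close> a type variable covers compact metrizable spaces over every type.\<close>

definition lusin_space :: "'b itself \<Rightarrow> 'a measure \<Rightarrow> bool" where
  "lusin_space _ E \<longleftrightarrow>
     (\<exists>(K :: 'b topology) B. compact_space K \<and> metrizable_space K \<and>
        B \<in> sets (borel_measure_of K) \<and>
        isomorphic_measurable E (restrict_space (borel_measure_of K) B))"

definition markov_kernel :: "'a measure \<Rightarrow> ('a \<Rightarrow> 'a measure) \<Rightarrow> bool" where
  "markov_kernel E \<nu> \<longleftrightarrow> \<nu> \<in> E \<rightarrow>\<^sub>M prob_algebra E"

lemma markov_kernel_iff:
  "markov_kernel E \<nu> \<longleftrightarrow>
     (\<forall>x \<in> space E. prob_space (\<nu> x) \<and> sets (\<nu> x) = sets E) \<and>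
     (\<forall>A \<in> sets E. (\<lambda>x. measure (\<nu> x) A) \<in> borel_measurable E)"
proof
  assume "markov_kernel E \<nu>"
  then have k: "\<nu> \<in> E \<rightarrow>\<^sub>M prob_algebra E" by (simp add: markov_kernel_def)
  have "prob_space (\<nu> x) \<and> sets (\<nu> x) = sets E" if "x \<in> space E" for x
    using measurable_space[OF k that] by (auto simp: space_prob_algebra)
  moreover have "(\<lambda>x. measure (\<nu> x) A) \<in> borel_measurable E" if "A \<in> sets E" for A
    using measurable_compose[OF measurable_prob_algebraD[OF k]
        measurable_measure_subprob_algebra[OF that]] .
  ultimately show "(\<forall>x \<in> space E. prob_space (\<nu> x) \<and> sets (\<nu> x) = sets E) \<and>
     (\<forall>A \<in> sets E. (\<lambda>x. measure (\<nu> x) A) \<in> borel_measurable E)" by blast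
next
  assume a: "(\<forall>x \<in> space E. prob_space (\<nu> x) \<and> sets (\<nu> x) = sets E) \<and>
     (\<forall>A \<in> sets E. (\<lambda>x. measure (\<nu> x) A) \<in> borel_measurable E)"
  have e: "(\<lambda>x. emeasure (\<nu> x) A) \<in> borel_measurable E" if "A \<in> sets E" for A
  proof -
    have [measurable]: "(\<lambda>x. measure (\<nu> x) A) \<in> borel_measurable E" using a that by blast
    have "(\<lambda>x. ennreal (measure (\<nu> x) A)) \<in> borel_measurable E" by measurable
    moreover have "emeasure (\<nu> x) A = ennreal (measure (\<nu> x) A)" if "x \<in> space E" for x
      using a that finite_measure.emeasure_eq_measure[OF prob_space.finite_measure] by blast
    ultimately show ?thesis by (simp cong: measurable_cong)
  qed
  have "\<nu> \<in> E \<rightarrow>\<^sub>M subprob_algebra E"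
    by (rule measurable_subprob_algebra) (use a e prob_space_imp_subprob_space in auto)
  then show "markov_kernel E \<nu>"
    using a by (auto simp: markov_kernel_def prob_algebra_def intro!: measurable_restrict_space2)
qed

definition dynamical_system :: "'a measure \<Rightarrow> ('a \<Rightarrow> 'a) \<Rightarrow> bool" where
  "dynamical_system M T \<longleftrightarrow> T \<in> M \<rightarrow>\<^sub>M M"

definition tensor_one :: "('a \<Rightarrow> real) \<Rightarrow> 'a \<times> 'c \<Rightarrow> real" where
  "tensor_one f = (\<lambda>(x, y). f x)"

end

theory Submission
  imports Defs
begin

text \<open>
  Every nonempty Lusin space is a measurable retract of the real line: a compact metrizable space
  embeds into \<open>\<real>\<^sup>\<nat>\<close> by the distances to a countable dense set, with compact, hence Borel, image,
  and a point of \<open>\<real>\<^sup>\<nat>\<close> is coded by a single real number through the 0-1 digits recording which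
  rationals lie above which coordinates. Retracts suffice, so the Borel isomorphism theorem is not
  needed. With \<open>F = (0,1)\<close>, \<open>\<mu>\<close> Lebesgue measure, and a section \<open>s\<close> and a retraction \<open>q\<close>, take
  \<open>T (x, y) = (q (Q\<^sub>x y), y)\<close> with \<open>Q\<^sub>x\<close> the quantile function of the image of \<open>\<nu> x\<close> under \<open>s\<close>.
\<close>

section \<open>Measurable retracts\<close>

text \<open>Unlike an isomorphism this is one-sided: \<open>q \<circ> s\<close> is the identity, so
  a function \<open>f\<close> on \<open>M\<close> is recovered from \<open>f \<circ> q\<close> on
  \<open>N\<close>. A retract of a nonempty space is nonempty, since \<open>q\<close> maps into
  it.\<close>

definition measurable_retract :: "'a measure \<Rightarrow> 'b measure \<Rightarrow> bool" where
  "measurable_retract M N \<longleftrightarrow> (\<exists>s \<in> M \<rightarrow>\<^sub>M N. \<exists>q \<in> N \<rightarrow>\<^sub>M M. \<forall>x \<in> space M. q (s x) = x)"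

lemma measurable_retractI:
  "s \<in> M \<rightarrow>\<^sub>M N \<Longrightarrow> q \<in> N \<rightarrow>\<^sub>M M \<Longrightarrow> (\<And>x. x \<in> space M \<Longrightarrow> q (s x) = x) \<Longrightarrow> measurable_retract M N"
  unfolding measurable_retract_def by blast

lemma measurable_retract_trans:
  assumes "measurable_retract L M" "measurable_retract M N"
  shows "measurable_retract L N"
proof -
  obtain s q where s: "s \<in> L \<rightarrow>\<^sub>M M" and q: "q \<in> M \<rightarrow>\<^sub>M L" and sq: "\<And>x. x \<in> space L \<Longrightarrow> q (s x) = x"
    using assms(1) unfolding measurable_retract_def by blast
  obtain s' q' where s': "s' \<in> M \<rightarrow>\<^sub>M N" and q': "q' \<in> N \<rightarrow>\<^sub>M M"
    and sq': "\<And>x. x \<in> space M \<Longrightarrow> q' (s' x) = x"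
    using assms(2) unfolding measurable_retract_def by blast
  show ?thesis
  proof (rule measurable_retractI)
    show "(\<lambda>x. s' (s x)) \<in> L \<rightarrow>\<^sub>M N" using s s' by simp
    show "(\<lambda>x. q (q' x)) \<in> N \<rightarrow>\<^sub>M L" using q q' by simp
    show "q (q' (s' (s x))) = x" if "x \<in> space L" for x
      using measurable_space[OF s that] sq[OF that] sq' by simp
  qed
qed

text \<open>The section is the inclusion; the retraction collapses the complement of
  \<open>B\<close> to one chosen point of \<open>B\<close>.\<close>

lemma measurable_retract_restrict_space:
  assumes B: "B \<in> sets M" and ne: "B \<noteq> {}"
  shows "measurable_retract (restrict_space M B) M"
proof -
  obtain b where b: "b \<in> B" using ne by blast
  have BM: "B \<subseteq> space M" by (rule sets.sets_into_space[OF B])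
  show ?thesis
  proof (rule measurable_retractI)
    show "(\<lambda>x. x) \<in> restrict_space M B \<rightarrow>\<^sub>M M"
      by (rule measurable_restrict_space1) simp
    have "(\<lambda>x. if x \<in> B then x else b) \<in> M \<rightarrow>\<^sub>M M"
      using B b BM by (intro measurable_If_set) auto
    then show "(\<lambda>x. if x \<in> B then x else b) \<in> M \<rightarrow>\<^sub>M restrict_space M B"
      using b by (intro measurable_restrict_space2) auto
  qed (auto simp: space_restrict_space)
qed

section \<open>Coding sequences of reals by reals\<close>

text \<open>After scaling by \<open>4 ^ Suc n\<close>, the digits before \<open>n\<close> contribute
  multiples of 4, digit \<open>n\<close> contributes 0 or 1, and the later ones at most 1/3, which
  the floor removes. An even base lets parity read the digit; in base 2 a tail of ones would sum to
  1 and carry.\<close>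

lemma odd_floor_binary_expansion_base_4:
  fixes b :: "nat \<Rightarrow> bool"
  shows "odd \<lfloor>4 ^ Suc n * (\<Sum>i. of_bool (b i) * (1/4 :: real) ^ Suc i)\<rfloor> \<longleftrightarrow> b n"
proof -
  define f where "f i = of_bool (b i) * (1/4 :: real) ^ Suc i" for i
  have g: "summable (\<lambda>i. (1/4 :: real) ^ Suc i)"
    by (subst summable_Suc_iff) simp
  have sf: "summable f"
    by (rule summable_comparison_test'[OF g, of 0]) (auto simp: f_def)
  have sf': "summable (\<lambda>i. f (i + Suc n))"
    using sf by (rule summable_ignore_initial_segment)
  define t where "t = 4 ^ Suc n * (\<Sum>i. f (i + Suc n))"
  define A :: int where "A = (\<Sum>i<Suc n. of_bool (b i) * 4 ^ (n - i))"
  have "real_of_int A = (\<Sum>i<Suc n. of_bool (b i) * 4 ^ (n - i))"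
    by (simp add: A_def)
  also have "\<dots> = (\<Sum>i<Suc n. 4 ^ Suc n * f i)"
  proof (rule sum.cong[OF refl])
    fix i assume "i \<in> {..<Suc n}"
    then have "Suc n = (n - i) + Suc i" by auto
    then have "(4::real) ^ Suc n = 4 ^ (n - i) * 4 ^ Suc i" by (metis power_add)
    then show "of_bool (b i) * 4 ^ (n - i) = 4 ^ Suc n * f i"
      by (simp add: f_def power_one_over)
  qed
  finally have A: "real_of_int A = 4 ^ Suc n * (\<Sum>i<Suc n. f i)"
    by (simp only: sum_distrib_left)
  have split: "4 ^ Suc n * (\<Sum>i. f i) = real_of_int A + t"
    unfolding A t_def by (subst suminf_split_initial_segment[OF sf, of "Suc n"]) (simp add: algebra_simps)
  have t0: "0 \<le> t"
    unfolding t_def by (intro mult_nonneg_nonneg suminf_nonneg sf') (auto simp: f_def)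
  \<comment> \<open>The extreme case, in which every digit after \<open>n\<close> is 1.\<close>
  have s4: "(\<lambda>i. (1/4::real) ^ Suc n * ((1/4) * (1/4) ^ i)) sums ((1/4) ^ Suc n * ((1/4) * (1 / (1 - 1/4))))"
    by (intro sums_mult geometric_sums) simp
  have "(\<Sum>i. f (i + Suc n)) \<le> (\<Sum>i. (1/4::real) ^ Suc n * ((1/4) * (1/4) ^ i))"
    by (rule suminf_le[OF _ sf' sums_summable[OF s4]]) (auto simp: f_def power_add)
  also have "\<dots> = (1/4) ^ Suc n * (1/3)"
    using sums_unique[OF s4] by simp
  finally have "t \<le> 4 ^ Suc n * ((1/4) ^ Suc n * (1/3))"
    unfolding t_def by (rule mult_left_mono) simp
  also have "\<dots> = 1/3" by (simp add: power_one_over)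
  finally have "\<lfloor>4 ^ Suc n * (\<Sum>i. f i)\<rfloor> = A"
    unfolding split using t0 by linarith
  moreover have "A = (\<Sum>i<n. of_bool (b i) * 4 ^ (n - i)) + of_bool (b n)"
    by (simp add: A_def)
  moreover have "even (\<Sum>i<n. of_bool (b i) * 4 ^ (n - i) :: int)"
    by (rule dvd_sum) auto
  ultimately show ?thesis by (simp add: f_def)
qed

text \<open>Rationals are dense above \<open>x\<close>; the value \<infinity> makes the other
  indices neutral in the infimum. This decodes a coordinate from its bits.\<close>

lemma INF_rationals_above:
  fixes x :: real
  shows "(INF j. if x < of_rat (from_nat j) then ereal (of_rat (from_nat j)) else \<infinity>) = ereal x"
proof (rule antisym)
  show "(INF j. if x < of_rat (from_nat j) then ereal (of_rat (from_nat j)) else \<infinity>) \<le> ereal x"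
  proof (rule dense_ge)
    fix z assume "ereal x < z"
    then obtain r where r: "x < of_rat r" "ereal (of_rat r) < z"
      by (metis ereal_dense2 ereal_less_eq(3) less_ereal.simps(1) of_rat_dense order_less_trans)
    show "(INF j. if x < of_rat (from_nat j) then ereal (of_rat (from_nat j)) else \<infinity>) \<le> z"
      by (rule INF_lower2[of "to_nat r"]) (use r in auto)
  qed
  show "ereal x \<le> (INF j. if x < of_rat (from_nat j) then ereal (of_rat (from_nat j)) else \<infinity>)"
    by (rule INF_greatest) auto
qed

lemma measurable_retract_sequences_real:
  "measurable_retract (borel :: (nat \<Rightarrow> real) measure) (borel :: real measure)"
proof -
  define b where "b v n = (case prod_decode n of (i, j) \<Rightarrow> v i < real_of_rat (from_nat j))"
    for v :: "nat \<Rightarrow> real" and n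
  define s where "s v = (\<Sum>n. of_bool (b v n) * (1/4 :: real) ^ Suc n)" for v
  \<comment> \<open>\<open>r\<close> need not be a code: the infimum always exists in
    \<open>ereal\<close>, and \<open>real_of_ereal\<close> sends infinite values to 0, so
    \<open>q\<close> is total and measurable.\<close>
  define q where "q r i = real_of_ereal
      (INF j. if odd \<lfloor>4 ^ Suc (prod_encode (i, j)) * r\<rfloor> then ereal (of_rat (from_nat j)) else \<infinity>)"
    for r :: real and i
  show ?thesis
  proof (rule measurable_retractI)
    have [measurable]: "Measurable.pred borel (\<lambda>v. b v n)" for n
      by (cases "prod_decode n") (simp add: b_def)
    show "s \<in> borel_measurable borel"
      unfolding s_def[abs_def] by measurable
    have "(\<lambda>r. q r i) \<in> borel_measurable borel" for i
      unfolding q_def by measurable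
    then show "q \<in> borel_measurable borel"
      by (rule measurable_coordinatewise_then_product)
    show "q (s v) = v" for v
    proof
      fix i
      show "q (s v) i = v i"
        unfolding q_def s_def odd_floor_binary_expansion_base_4 b_def
          prod_encode_inverse prod.case INF_rationals_above
        by simp
    qed
  qed
qed

section \<open>Lusin spaces as retracts of the real line\<close>

text \<open>Total boundedness gives finite \<open>1 / Suc k\<close>-nets, whose union is countable
  and dense. If \<open>z\<close> in a net is close to \<open>x\<close> and equally far from
  \<open>y\<close>, then \<open>d x y\<close> is at most twice \<open>d z x\<close>, hence
  arbitrarily small.\<close>

lemma (in Metric_space) compact_space_imp_separating_sequence:
  assumes "compact_space mtopology" "M \<noteq> {}"
  obtains a :: "nat \<Rightarrow> 'a"
  where "range a \<subseteq> M" "\<And>x y. x \<in> M \<Longrightarrow> y \<in> M \<Longrightarrow> (\<And>n. d (a n) x = d (a n) y) \<Longrightarrow> x = y"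
proof -
  have "mtotally_bounded M"
    using assms(1) by (metis compact_space_def compactin_imp_mtotally_bounded topspace_mtopology)
  then have "\<exists>K. finite K \<and> K \<subseteq> M \<and> M \<subseteq> (\<Union>x\<in>K. mball x (1 / Suc k))" for k
    unfolding mtotally_bounded_def by simp
  then obtain K where fin: "\<And>k. finite (K k)" and sub: "\<And>k. K k \<subseteq> M"
    and cov: "\<And>k. M \<subseteq> (\<Union>x\<in>K k. mball x (1 / Suc k))" by metis
  let ?A = "\<Union>k. K k"
  have ne: "?A \<noteq> {}" using cov assms(2) by fastforce
  have cA: "countable ?A" using fin by (simp add: countable_finite)
  show ?thesis
  proof (rule that)
    show "range (from_nat_into ?A) \<subseteq> M"
      using range_from_nat_into[OF ne cA] sub by auto
    fix x y assume x: "x \<in> M" and y: "y \<in> M" and eq: "\<And>n. d (from_nat_into ?A n) x = d (from_nat_into ?A n) y"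
    have "d x y < e" if e: "0 < e" for e
    proof -
      obtain k :: nat where k: "1 / Suc k < e / 2" using e nat_approx_posE[of "e/2"] by auto
      obtain z where z: "z \<in> K k" "x \<in> mball z (1 / Suc k)" using cov x by blast
      obtain n where n: "from_nat_into ?A n = z"
        using from_nat_into_surj[OF cA] z(1) by blast
      have zx: "d z x < e / 2" using z k by (simp add: in_mball)
      then have "d z y < e / 2" using eq[of n] n by simp
      moreover have "d x y \<le> d z x + d z y"
        using triangle[of x z y] x y z sub commute by (metis in_mball)
      ultimately show ?thesis using zx by linarith
    qed
    then have "d x y \<le> 0" by (metis less_irrefl not_le)
    then show "x = y" using x y by (metis nonneg order_antisym zero)
  qed
qed

lemma space_borel_measure_of: "space (borel_measure_of K) = topspace K"
  unfolding borel_measure_of_def by (rule space_measure_of) (auto dest: openin_subset)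

lemma borel_measure_of_openin: "openin K U \<Longrightarrow> U \<in> sets (borel_measure_of K)"
  unfolding borel_measure_of_def by (subst sets_measure_of) (auto dest: openin_subset)

lemma measurable_into_borel_measure_of:
  assumes "f \<in> space M \<rightarrow> topspace K" "\<And>U. openin K U \<Longrightarrow> f -` U \<inter> space M \<in> sets M"
  shows "f \<in> M \<rightarrow>\<^sub>M borel_measure_of K"
  unfolding borel_measure_of_def
  by (rule measurable_measure_of) (use assms in \<open>auto dest: openin_subset\<close>)

lemma continuous_map_imp_borel_measurable:
  assumes "continuous_map K euclidean f"
  shows "f \<in> borel_measurable (borel_measure_of K)"
proof (rule borel_measurableI)
  fix S :: "'b set" assume "open S"
  then have "openin K {x \<in> topspace K. f x \<in> S}"
    using assms by (simp add: continuous_map_def)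
  moreover have "f -` S \<inter> space (borel_measure_of K) = {x \<in> topspace K. f x \<in> S}"
    by (auto simp: space_borel_measure_of)
  ultimately show "f -` S \<inter> space (borel_measure_of K) \<in> sets (borel_measure_of K)"
    by (simp add: borel_measure_of_openin)
qed

text \<open>Closed sets are compact, so their images are compact and hence closed. By injectivity
  the image of an open set is a difference of two closed sets, which makes the inverse on the image
  measurable. Off the image the retraction is constant.\<close>

lemma continuous_injection_imp_measurable_retract:
  fixes f :: "'a \<Rightarrow> 'b :: t2_space"
  assumes K: "compact_space K" and ne: "topspace K \<noteq> {}"
    and f: "continuous_map K euclidean f" and inj: "inj_on f (topspace K)"
  shows "measurable_retract (borel_measure_of K) (borel :: 'b measure)"
proof -
  obtain k where k: "k \<in> topspace K" using ne by blast
  have closed: "closed (f ` C)" if "closedin K C" for C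
    using image_compactin[OF closedin_compact_space[OF K that] f]
    by (simp add: compact_imp_closed)
  let ?C = "f ` topspace K"
  let ?g = "\<lambda>v. if v \<in> ?C then inv_into (topspace K) f v else k"
  have C: "?C \<in> sets borel" using closed[of "topspace K"] by simp
  show ?thesis
  proof (rule measurable_retractI)
    show "f \<in> borel_measurable (borel_measure_of K)"
      using f by (rule continuous_map_imp_borel_measurable)
    show "?g (f x) = x" if "x \<in> space (borel_measure_of K)" for x
      using that inj by (simp add: space_borel_measure_of)
    show "?g \<in> borel \<rightarrow>\<^sub>M borel_measure_of K"
    proof (rule measurable_into_borel_measure_of)
      show "?g \<in> space borel \<rightarrow> topspace K"
        using k by (auto simp: inj)
      fix U assume U: "openin K U"
      have UK: "U \<subseteq> topspace K" by (rule openin_subset[OF U])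
      have "f ` U = ?C - f ` (topspace K - U)"
        using UK inj by (auto simp: inj_on_def)
      moreover have "closed (f ` (topspace K - U))"
        using U by (intro closed) auto
      ultimately have fU: "f ` U \<in> sets borel" using C by auto
      have "?g -` U \<inter> space borel = f ` U \<union> (if k \<in> U then - ?C else {})"
        using UK inj by (auto simp: subset_iff split: if_splits)
      then show "?g -` U \<inter> space borel \<in> sets borel"
        using fU C by auto
    qed
  qed
qed

lemma compact_metrizable_measurable_retract:
  assumes K: "compact_space K" "metrizable_space K" and ne: "topspace K \<noteq> {}"
  shows "measurable_retract (borel_measure_of K) (borel :: (nat \<Rightarrow> real) measure)"
proof -
  obtain M d where "Metric_space M d" and eq: "K = Metric_space.mtopology M d"
    using K(2) unfolding metrizable_space_def by blast
  then interpret Metric_space M d by simp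
  have M: "M = topspace K" by (simp add: eq)
  obtain a :: "nat \<Rightarrow> 'a" where a: "range a \<subseteq> M"
    and sep: "\<And>x y. x \<in> M \<Longrightarrow> y \<in> M \<Longrightarrow> (\<And>n. d (a n) x = d (a n) y) \<Longrightarrow> x = y"
    using compact_space_imp_separating_sequence K(1) ne unfolding eq topspace_mtopology by metis
  have "continuous_map K euclidean (d (a n))" for n
    using continuous_on_mdist[of "a n" "metric (M, d)"] a
    by (auto simp: eq mtopology_of_def)
  \<comment> \<open>The topology of \<open>nat \<Rightarrow> real\<close> is the product topology,
    so continuity is checked coordinatewise.\<close>
  then have "continuous_map K euclidean (\<lambda>x n. d (a n) x)"
    by (simp flip: euclidean_product_topology add: continuous_map_componentwise_UNIV)
  moreover have "inj_on (\<lambda>x n. d (a n) x) (topspace K)"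
    unfolding M[symmetric] by (rule inj_onI) (metis sep)
  ultimately show ?thesis
    by (rule continuous_injection_imp_measurable_retract[OF K(1) ne])
qed

text \<open>Retractions compose along the chain \<open>E\<close>, \<open>B\<close>,
  \<open>K\<close>, sequences of reals, reals.\<close>

lemma lusin_space_measurable_retract_real:
  assumes "lusin_space TYPE('b) E" "space E \<noteq> {}"
  shows "measurable_retract E (borel :: real measure)"
proof -
  obtain K :: "'b topology" and B where K: "compact_space K" "metrizable_space K"
    and B: "B \<in> sets (borel_measure_of K)"
    and iso: "isomorphic_measurable E (restrict_space (borel_measure_of K) B)"
    using assms(1) unfolding lusin_space_def by blast
  have r: "measurable_retract E (restrict_space (borel_measure_of K) B)"
    using iso unfolding isomorphic_measurable_def measurable_retract_def by blast
  then have "B \<noteq> {}"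
    using assms(2) unfolding measurable_retract_def
    by (auto simp: space_restrict_space dest: measurable_space)
  moreover from this have "topspace K \<noteq> {}"
    using sets.sets_into_space[OF B] by (auto simp: space_borel_measure_of)
  ultimately show ?thesis
    by (meson r B K measurable_retract_trans measurable_retract_restrict_space
        compact_metrizable_measurable_retract measurable_retract_sequences_real)
qed

section \<open>The quantile transform of a kernel\<close>

abbreviation quantile :: "real measure \<Rightarrow> real \<Rightarrow> real" where
  "quantile D y \<equiv> Inf {t. y \<le> cdf D t}"

text \<open>For \<open>0 < y < 1\<close> the quantile is at most \<open>t\<close> iff
  \<open>y \<le> cdf (D x) t\<close>. Each sublevel set thus compares two jointly measurable
  functions of \<open>(x, y)\<close>. Outside the open interval the infimum may range over an empty
  set or one unbounded below.\<close>

lemma measurable_quantile_kernel: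
  assumes D: "\<And>x. x \<in> space E \<Longrightarrow> real_distribution (D x)"
    and meas: "\<And>t. (\<lambda>x. cdf (D x) t) \<in> borel_measurable E"
  shows "(\<lambda>(x, y). quantile (D x) y)
    \<in> borel_measurable (E \<Otimes>\<^sub>M restrict_space lborel {0<..<1})"
  (is "?Q \<in> borel_measurable ?P")
proof (subst borel_measurable_iff_le, intro allI)
  fix t
  have [measurable]: "(\<lambda>x. cdf (D x) t) \<in> borel_measurable E" by (rule meas)
  have [measurable]: "(\<lambda>y. y) \<in> borel_measurable (restrict_space lborel {0<..<1::real})"
    by (rule measurable_restrict_space1) simp
  have "quantile (D x) y \<le> t \<longleftrightarrow> y \<le> cdf (D x) t" if "x \<in> space E" "0 < y" "y < 1" for x y
  proof -
    interpret cdf_distribution "D x"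
      unfolding cdf_distribution_def by (rule D[OF that(1)])
    show ?thesis using pseudoinverse[of y t] that by blast
  qed
  then have "{w \<in> space ?P. ?Q w \<le> t} = {w \<in> space ?P. snd w \<le> cdf (D (fst w)) t}"
    by (auto simp: space_pair_measure space_restrict_space)
  also have "\<dots> \<in> sets ?P" by measurable
  finally show "{w \<in> space ?P. ?Q w \<le> t} \<in> sets ?P" .
qed

theorem theorem2p3:
  fixes E :: "'a measure" and \<nu> :: "'a \<Rightarrow> 'a measure"
  assumes "lusin_space TYPE('b) E"
    and "markov_kernel E \<nu>"
  shows "\<exists>(F :: real measure) (\<mu> :: real measure) (T :: 'a \<times> real \<Rightarrow> 'a \<times> real).
    sets \<mu> = sets F \<and> prob_space \<mu> \<and>
    dynamical_system (E \<Otimes>\<^sub>M F) T \<and>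
    (\<forall>f \<in> borel_measurable E. bounded (f ` space E) \<longrightarrow>
      (\<forall>x \<in> space E. (\<integral>y. tensor_one f (T (x, y)) \<partial>\<mu>) = (\<integral>z. f z \<partial>\<nu> x)))"
proof -
  define \<mu> :: "real measure" where "\<mu> = restrict_space lborel {0<..<1}"
  have \<mu>: "prob_space \<mu>"
    by (auto simp: \<mu>_def emeasure_restrict_space space_restrict_space intro!: prob_spaceI)
  show ?thesis
  proof (cases "space E = {}")
    \<comment> \<open>The real line has no map into an empty \<open>E\<close>, so there is no
      retraction here; the integral identity is vacuous.\<close>
    case True
    then have "dynamical_system (E \<Otimes>\<^sub>M \<mu>) id"
      by (simp add: dynamical_system_def)
    then show ?thesis using \<mu> True by blast
  next
    case False
    obtain s q where s [measurable]: "s \<in> E \<rightarrow>\<^sub>M (borel :: real measure)"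
      and q [measurable]: "q \<in> borel \<rightarrow>\<^sub>M E" and qs: "\<And>x. x \<in> space E \<Longrightarrow> q (s x) = x"
      using lusin_space_measurable_retract_real[OF assms(1) False]
      unfolding measurable_retract_def by blast
    have ker: "prob_space (\<nu> x)" "sets (\<nu> x) = sets E" if "x \<in> space E" for x
      using assms(2) that unfolding markov_kernel_iff by auto
    define D where "D x = distr (\<nu> x) borel s" for x
    have s\<nu>: "s \<in> borel_measurable (\<nu> x)" if "x \<in> space E" for x
      using s measurable_cong_sets[OF ker(2)[OF that] refl] by blast
    have D: "real_distribution (D x)" if "x \<in> space E" for x
      unfolding D_def using prob_space.real_distribution_distr[OF ker(1) s\<nu>] that by blast
    \<comment> \<open>For fixed \<open>t\<close> this is the kernel evaluated at the fixed
      measurable set of points whose \<open>s\<close>-value is at most \<open>t\<close>.\<close>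
    have "(\<lambda>x. cdf (D x) t) \<in> borel_measurable E" for t
    proof -
      have "(\<lambda>x. measure (\<nu> x) (s -` {..t} \<inter> space E)) \<in> borel_measurable E"
        using assms(2) measurable_sets[OF s, of "{..t}"] unfolding markov_kernel_iff by auto
      moreover have "cdf (D x) t = measure (\<nu> x) (s -` {..t} \<inter> space E)" if "x \<in> space E" for x
        using s\<nu>[OF that] sets_eq_imp_space_eq[OF ker(2)[OF that]]
        by (simp add: D_def cdf_def measure_distr)
      ultimately show ?thesis by (simp cong: measurable_cong)
    qed
    then have Q [measurable]: "(\<lambda>(x, y). quantile (D x) y) \<in> borel_measurable (E \<Otimes>\<^sub>M \<mu>)"
      unfolding \<mu>_def using D by (rule measurable_quantile_kernel[rotated])
    \<comment> \<open>\<open>tensor_one\<close> sees only the first coordinate; \<open>y\<close> is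
      carried along so that \<open>T\<close> stays in the product.\<close>
    define T where "T = (\<lambda>(x, y). (q (quantile (D x) y), y))"
    have "T \<in> E \<Otimes>\<^sub>M \<mu> \<rightarrow>\<^sub>M E \<Otimes>\<^sub>M \<mu>"
    proof -
      have "(\<lambda>w. (q ((\<lambda>(x, y). quantile (D x) y) w), snd w)) \<in> E \<Otimes>\<^sub>M \<mu> \<rightarrow>\<^sub>M E \<Otimes>\<^sub>M \<mu>"
        by measurable
      then show ?thesis by (simp add: T_def case_prod_beta')
    qed
    \<comment> \<open>The quantile function pushes \<open>\<mu>\<close> forward to
      \<open>D x\<close>, which is the image of \<open>\<nu> x\<close> under \<open>s\<close>; then
      \<open>q\<close> undoes \<open>s\<close>.\<close>
    moreover have "(\<integral>y. tensor_one f (T (x, y)) \<partial>\<mu>) = (\<integral>z. f z \<partial>\<nu> x)"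
      if f [measurable]: "f \<in> borel_measurable E" and x: "x \<in> space E" for f x
    proof -
      interpret cdf_distribution "D x"
        unfolding cdf_distribution_def by (rule D[OF x])
      have Qx: "quantile (D x) \<in> borel_measurable \<mu>"
        using measurable_Pair2[OF Q x] by simp
      have "(\<integral>y. tensor_one f (T (x, y)) \<partial>\<mu>) = (\<integral>y. f (q (quantile (D x) y)) \<partial>\<mu>)"
        by (simp add: tensor_one_def T_def)
      also have "\<dots> = (\<integral>t. f (q t) \<partial>distr \<mu> borel (quantile (D x)))"
        using Qx by (subst integral_distr) auto
      also have "\<dots> = (\<integral>t. f (q t) \<partial>D x)"
        unfolding \<mu>_def distr_I_eq_M ..
      also have "\<dots> = (\<integral>z. f (q (s z)) \<partial>\<nu> x)"
        unfolding D_def using s\<nu>[OF x] by (subst integral_distr) auto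
      also have "\<dots> = (\<integral>z. f z \<partial>\<nu> x)"
        using qs sets_eq_imp_space_eq[OF ker(2)[OF x]] by (intro Bochner_Integration.integral_cong) auto
      finally show ?thesis .
    qed
    ultimately show ?thesis
      using \<mu> unfolding dynamical_system_def by blast
  qed
qed

end
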